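(* For all $p>1$ and $x>0$, $$\left(\frac{\sinh_p(x)}{x}\right)^p+\frac{\tanh_p(x)}{x}>2.$$
   Context: For $1<p<\infty$ define $\mathrm{arcsinh}_p(x)=\int_0^x (1+t^p)^{-1/p}\,dt$ for $x\ge 0$. The generalized hyperbolic sine $\sinh_p:[0,\infty)\to[0,\infty)$ is the inverse of $\mathrm{arcsinh}_p$, $\cosh_p(x)=\frac{d}{dx}\sinh_p(x)$ (so $\cosh_p(x)^p-\sinh_p(x)^p=1$ for $x\ge0$), and $\tanh_p(x)=\sinh_p(x)/\cosh_p(x)$. *)

theory Defs
  imports "HOL-Analysis.Analysis"
begin

definition arcsinh_p :: "real \<Rightarrow> real \<Rightarrow> real" where
  "arcsinh_p p x = integral {0..x} (\<lambda>t. (1 + t powr p) powr (- 1 / p))"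

(* For p > 1, arcsinh_p p is a strictly increasing bijection of {0..} onto {0..}. *)
definition sinh_p :: "real \<Rightarrow> real \<Rightarrow> real" where
  "sinh_p p = inv_into {0..} (arcsinh_p p)"

(* sinh_p p is only meaningful on {0..}, so the derivative is taken within that set:
   it is the right derivative at 0 and the ordinary derivative at every x > 0. *)
definition cosh_p :: "real \<Rightarrow> real \<Rightarrow> real" where
  "cosh_p p x = vector_derivative (sinh_p p) (at x within {0..})"

definition tanh_p :: "real \<Rightarrow> real \<Rightarrow> real" where
  "tanh_p p x = sinh_p p x / cosh_p p x"

end

theory Submission imports Defs begin

text \<open>
  By the arithmetic-geometric mean inequality it suffices that the product of the two summands,
  \<open>(sinh\<^sub>p x / x)\<^bsup>p + 1\<^esup> / cosh\<^sub>p x\<close>, exceeds 1. With \<open>s = sinh\<^sub>p x\<close> this Lazarevic-type inequality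
  reads \<open>arcsinh\<^sub>p s < s (1 + s\<^sup>p)\<^bsup>- 1 / (p (p + 1))\<^esup>\<close>; both sides vanish at 0, and comparing
  derivatives reduces it to Bernoulli's inequality with exponent \<open>p / (p + 1)\<close>.
\<close>

text \<open>Strict Bernoulli inequality: the difference of the two sides vanishes at 0 and has
  derivative \<open>b - b * (1 + y) powr (b - 1)\<close>, which is positive for y > 0 because b - 1
  < 0.\<close>

lemma powr_one_plus_less:
  fixes b u :: real
  assumes "0 < b" "b < 1" "0 < u"
  shows "(1 + u) powr b < 1 + b * u"
proof -
  let ?f = "\<lambda>u. 1 + b * u - (1 + u) powr b"
  have "?f 0 < ?f u"
  proof (rule DERIV_pos_imp_increasing_open[where f = ?f])
    fix y :: real assume y: "0 < y" "y < u"
    have "(1 + y) powr (b - 1) < 1"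
      using y assms powr_less_mono[of "b - 1" 0 "1 + y"] by simp
    moreover have "(?f has_real_derivative b - b * (1 + y) powr (b - 1)) (at y)"
      using y by (auto intro!: derivative_eq_intros)
    moreover from calculation have "b * (1 + y) powr (b - 1) < b"
      using assms by simp
    ultimately show "\<exists>d. (?f has_real_derivative d) (at y) \<and> d > 0"
      by (intro exI[of _ "b - b * (1 + y) powr (b - 1)"]) auto
  qed (use assms in \<open>auto intro!: continuous_intros\<close>)
  then show ?thesis by simp
qed

lemma one_plus_powr_pos: "1 + t powr p > 0" for t p :: real
  by (simp add: add_pos_nonneg)

context
  fixes p :: real
  assumes p: "p > 1"
begin

text \<open>The exponent \<open>c\<close> is left free so as to cover both the integrand of
  \<open>arcsinh_p\<close> and the comparison function in \<open>arcsinh_p_less\<close>.\<close>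

lemma continuous_on_one_plus_powr_powr:
  "continuous_on {0..b} (\<lambda>t::real. (1 + t powr p) powr c)"
proof -
  have "continuous_on {0..b} (\<lambda>t::real. t powr p)"
    using p by (intro continuous_on_powr' continuous_intros) auto
  moreover have "1 + t powr p \<noteq> 0" for t :: real
    using one_plus_powr_pos[of t p] by linarith
  ultimately show ?thesis
    by (auto intro: continuous_on_powr[OF continuous_on_add[OF continuous_on_const] continuous_on_const])
qed

lemma arcsinh_p_zero [simp]: "arcsinh_p p 0 = 0"
  by (simp add: arcsinh_p_def)

lemma continuous_on_arcsinh_p: "continuous_on {0..b} (arcsinh_p p)"
  unfolding arcsinh_p_def
  by (intro indefinite_integral_continuous_1 integrable_continuous_interval
        continuous_on_one_plus_powr_powr)

lemma has_real_derivative_arcsinh_p: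
  assumes "s > 0"
  shows "(arcsinh_p p has_real_derivative (1 + s powr p) powr (- 1 / p)) (at s)"
proof -
  \<comment> \<open>The right end \<open>s + 1\<close> makes \<open>s\<close> an interior point, so
    the derivative within the interval is the full derivative.\<close>
  have "(arcsinh_p p has_real_derivative (1 + s powr p) powr (- 1 / p)) (at s within {0..s + 1})"
    unfolding arcsinh_p_def
    by (rule integral_has_real_derivative[OF continuous_on_one_plus_powr_powr])
       (use assms in auto)
  moreover have "at s within {0..s + 1} = at s"
    using assms by (intro at_within_interior) auto
  ultimately show ?thesis by simp
qed

text \<open>The derivative is known only at positive points; the mean value argument on the open
  interval together with continuity on the closed one includes \<open>a = 0\<close>.\<close>

lemma arcsinh_p_strict_mono:
  assumes "0 \<le> a" "a < b"
  shows "arcsinh_p p a < arcsinh_p p b"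
proof (rule DERIV_pos_imp_increasing_open[OF assms(2)])
  fix y assume "a < y" "y < b"
  then have "y > 0" using assms by simp
  then show "\<exists>d. (arcsinh_p p has_real_derivative d) (at y) \<and> d > 0"
    using has_real_derivative_arcsinh_p[of y] one_plus_powr_pos[of y p] by fastforce
next
  show "continuous_on {a..b} (arcsinh_p p)"
    using continuous_on_arcsinh_p[of b] assms by (auto elim: continuous_on_subset)
qed

lemma inj_on_arcsinh_p: "inj_on (arcsinh_p p) {0..}"
  by (rule linorder_inj_onI) (auto dest: arcsinh_p_strict_mono)

text \<open>Superadditivity of the p-th power gives 1 + t^p \<le> (1 + t)^p, and the negative
  exponent -1/p reverses the inequality.\<close>

lemma inverse_le_arcsinh_p_integrand:
  fixes t :: real
  assumes "t > 0"
  shows "1 / (1 + t) \<le> (1 + t powr p) powr (- 1 / p)"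
proof -
  have "(1 + t) powr (p - 1) \<ge> 1"
    using assms p by (intro ge_one_powr_ge_zero) auto
  moreover have "t powr (p - 1) \<le> (1 + t) powr (p - 1)"
    using assms p by (intro powr_mono2) auto
  ultimately have "1 + t * t powr (p - 1) \<le> (1 + t) powr (p - 1) + t * (1 + t) powr (p - 1)"
    using assms by (intro add_mono mult_left_mono) auto
  also have "t * t powr (p - 1) = t powr p"
    using assms by (simp add: powr_diff)
  also have "(1 + t) powr (p - 1) + t * (1 + t) powr (p - 1) = (1 + t) * (1 + t) powr (p - 1)"
    by (simp add: algebra_simps)
  also have "\<dots> = (1 + t) powr p"
    using assms by (simp add: powr_diff)
  finally have "1 + t powr p \<le> (1 + t) powr p" .
  then have "((1 + t) powr p) powr (- 1 / p) \<le> (1 + t powr p) powr (- 1 / p)"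
    using p one_plus_powr_pos by (intro powr_mono2') auto
  moreover have "((1 + t) powr p) powr (- 1 / p) = 1 / (1 + t)"
    using assms p by (simp add: powr_powr powr_minus_divide)
  ultimately show ?thesis by simp
qed

text \<open>Integrated form of the previous bound. It makes \<open>arcsinh_p p\<close> unbounded, as
  surjectivity onto the half-line requires.\<close>

lemma ln_le_arcsinh_p:
  assumes "s \<ge> 0"
  shows "ln (1 + s) \<le> arcsinh_p p s"
proof -
  let ?f = "\<lambda>s. arcsinh_p p s - ln (1 + s)"
  have "?f 0 \<le> ?f s"
  proof (rule DERIV_nonneg_imp_increasing_open[where f = ?f, OF assms])
    fix y :: real assume "0 < y" "y < s"
    then show "\<exists>d. (?f has_real_derivative d) (at y) \<and> 0 \<le> d"
      using inverse_le_arcsinh_p_integrand[of y]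
      by (intro exI[of _ "(1 + y powr p) powr (- 1 / p) - 1 / (1 + y)"])
         (auto intro!: derivative_eq_intros has_real_derivative_arcsinh_p[THEN DERIV_cong])
  qed (auto intro!: continuous_intros continuous_on_arcsinh_p)
  then show ?thesis by simp
qed

lemma arcsinh_p_surj:
  assumes "x \<ge> 0"
  obtains s where "s \<ge> 0" "arcsinh_p p s = x"
proof -
  \<comment> \<open>The point \<open>exp x - 1\<close> solves ln (1 + s) = x, so the intermediate
    value theorem applies on the interval from 0 to it.\<close>
  have "x \<le> arcsinh_p p (exp x - 1)"
    using ln_le_arcsinh_p[of "exp x - 1"] assms by simp
  then show thesis
    using IVT'[of "arcsinh_p p" 0 x "exp x - 1"] assms continuous_on_arcsinh_p that by auto
qed

lemma arcsinh_p_sinh_p: "x \<ge> 0 \<Longrightarrow> arcsinh_p p (sinh_p p x) = x"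
  unfolding sinh_p_def by (rule f_inv_into_f) (metis arcsinh_p_surj atLeast_iff imageI)

lemma sinh_p_arcsinh_p: "s \<ge> 0 \<Longrightarrow> sinh_p p (arcsinh_p p s) = s"
  unfolding sinh_p_def by (simp add: inv_into_f_f inj_on_arcsinh_p)

lemma sinh_p_pos:
  assumes "x > 0"
  shows "sinh_p p x > 0"
proof -
  obtain s where s: "s \<ge> 0" "arcsinh_p p s = x"
    using arcsinh_p_surj[of x] assms by auto
  then have "s \<noteq> 0" using assms by auto
  then show ?thesis using s sinh_p_arcsinh_p by force
qed

text \<open>The derivative of the inverse function is the reciprocal of the integrand at
  \<open>sinh_p p x\<close>. This is the identity cosh_p^p - sinh_p^p = 1 solved for cosh_p.\<close>

lemma cosh_p_eq:
  assumes "x > 0"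
  shows "cosh_p p x = (1 + sinh_p p x powr p) powr (1 / p)"
proof -
  define s where "s = sinh_p p x"
  have s: "s > 0" "arcsinh_p p s = x"
    using sinh_p_pos arcsinh_p_sinh_p assms by (auto simp: s_def)
  \<comment> \<open>Radius \<open>s / 2\<close> keeps the neighbourhood of \<open>s\<close> inside
    the positive reals, where \<open>sinh_p p\<close> inverts \<open>arcsinh_p p\<close>.\<close>
  have c: "isCont (sinh_p p) (arcsinh_p p s)"
  proof (rule isCont_inverse_function[where f = "arcsinh_p p" and d = "s / 2"])
    fix z assume "\<bar>z - s\<bar> \<le> s / 2"
    then have z: "z > 0" using s by linarith
    show "sinh_p p (arcsinh_p p z) = z" using z by (simp add: sinh_p_arcsinh_p)
    show "isCont (arcsinh_p p) z"
      using z has_real_derivative_arcsinh_p DERIV_isCont by blast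
  qed (use s in auto)
  note pos = one_plus_powr_pos[of s p]
  have "(sinh_p p has_real_derivative inverse ((1 + s powr p) powr (- 1 / p))) (at x)"
    by (rule DERIV_inverse_function[where f = "arcsinh_p p" and a = 0 and b = "x + 1"])
       (use has_real_derivative_arcsinh_p[OF s(1)] c s pos assms arcsinh_p_sinh_p
         in \<open>auto simp: s_def\<close>)
  then have "(sinh_p p has_vector_derivative (1 + s powr p) powr (1 / p)) (at x)"
    by (simp add: has_real_derivative_iff_has_vector_derivative powr_minus)
  moreover have "at x within {0..} = at x"
    using assms by (intro at_within_interior) (simp add: interior_real_atLeast)
  ultimately show ?thesis
    unfolding cosh_p_def s_def by (simp add: vector_derivative_at)
qed

lemma arcsinh_p_less:
  assumes "s > 0"
  shows "arcsinh_p p s < s * (1 + s powr p) powr (- 1 / (p * (p + 1)))"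
proof -
  \<comment> \<open>With this \<open>a\<close>, raising (1 + s^p)^a to the power p + 1 yields (1 +
    s^p)^(1/p), which is cosh_p at the point where sinh_p equals s.\<close>
  define a where "a = 1 / (p * (p + 1))"
  let ?f = "\<lambda>s. s * (1 + s powr p) powr (- a) - arcsinh_p p s"
  have "?f 0 < ?f s"
  proof (rule DERIV_pos_imp_increasing_open[where f = ?f])
    fix y :: real assume y: "0 < y" "y < s"
    define u where "u = y powr p"
    have u: "u > 0" using y by (simp add: u_def)
    \<comment> \<open>The derivative of the first term of \<open>?f\<close> with (1 + u)^(-a-1)
      factored out; p * a = 1 / (p + 1) turns the remaining factor into the linear side of
      Bernoulli's inequality.\<close>
    define d where "d = (1 + u) powr (- a - 1) * (1 + p / (p + 1) * u)"
    have pa: "p * a = 1 / (p + 1)" using p by (simp add: a_def)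
    have "((\<lambda>s. s * (1 + s powr p) powr (- a)) has_real_derivative
        (1 + y powr p) powr (- a) + y * (- a * (1 + y powr p) powr (- a - 1) * (p * y powr (p - 1)))) (at y)"
      using y one_plus_powr_pos[of y p] by (auto intro!: derivative_eq_intros)
    moreover have "(1 + y powr p) powr (- a) + y * (- a * (1 + y powr p) powr (- a - 1) * (p * y powr (p - 1))) = d"
    proof -
      have "y * y powr (p - 1) = u" using y by (simp add: u_def powr_diff)
      moreover have "(1 + u) powr (- a) = (1 + u) powr (- a - 1) * (1 + u)"
        using u by (simp add: powr_diff)
      ultimately have "(1 + y powr p) powr (- a) + y * (- a * (1 + y powr p) powr (- a - 1) * (p * y powr (p - 1)))
          = (1 + u) powr (- a - 1) * (1 + u - p * a * u)"
        by (simp add: u_def algebra_simps)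
      also have "1 + u - p * a * u = 1 + p / (p + 1) * u"
        unfolding pa using p by (simp add: field_simps)
      finally show ?thesis by (simp add: d_def)
    qed
    ultimately have D: "(?f has_real_derivative d - (1 + u) powr (- 1 / p)) (at y)"
      unfolding u_def using y by (intro DERIV_diff has_real_derivative_arcsinh_p) auto
    \<comment> \<open>Splitting the same factor off the integrand leaves (1 + u)^(p/(p+1)), the
      power side of Bernoulli's inequality.\<close>
    have "- 1 / p = (- a - 1) + p / (p + 1)"
      using p by (simp add: a_def divide_simps) (simp add: algebra_simps)
    then have "(1 + u) powr (- 1 / p) = (1 + u) powr (- a - 1) * (1 + u) powr (p / (p + 1))"
      by (simp only: powr_add)
    also have "\<dots> < d"
      unfolding d_def using powr_one_plus_less[of "p / (p + 1)" u] u p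
      by (intro mult_strict_left_mono) auto
    finally show "\<exists>d. (?f has_real_derivative d) (at y) \<and> d > 0"
      using D by (intro exI[of _ "d - (1 + u) powr (- 1 / p)"]) auto
  next
    show "continuous_on {0..s} ?f"
      by (intro continuous_intros continuous_on_one_plus_powr_powr continuous_on_arcsinh_p)
  qed (rule assms)
  then show ?thesis by (simp add: a_def)
qed

text \<open>Apply \<open>arcsinh_p_less\<close> at s = sinh_p x, solve for s / x and raise to the
  power p + 1.\<close>

lemma cosh_p_less_sinh_p_div_powr:
  assumes "x > 0"
  shows "cosh_p p x < (sinh_p p x / x) powr (p + 1)"
proof -
  define s where "s = sinh_p p x"
  have s: "s > 0" "arcsinh_p p s = x"
    using sinh_p_pos arcsinh_p_sinh_p assms by (auto simp: s_def)
  note pos = one_plus_powr_pos[of s p]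
  define w where "w = (1 + s powr p) powr (1 / (p * (p + 1)))"
  have "x < s / w"
    using arcsinh_p_less[OF s(1)] s by (simp add: w_def powr_minus_divide)
  moreover have "w > 0" using pos by (simp add: w_def)
  ultimately have "w < s / x"
    using assms by (simp add: field_simps)
  then have "w powr (p + 1) < (s / x) powr (p + 1)"
    using p \<open>w > 0\<close> by (intro powr_less_mono2) auto
  moreover have "w powr (p + 1) = cosh_p p x"
    using p assms by (simp add: w_def powr_powr cosh_p_eq s_def)
  ultimately show ?thesis by (simp add: s_def)
qed

end

theorem corollary3p19:
  fixes p x :: real
  assumes "p > 1" and "x > 0"
  shows "(sinh_p p x / x) powr p + tanh_p p x / x > 2"
proof -
  define a b where "a = (sinh_p p x / x) powr p" and "b = tanh_p p x / x"
  have s: "sinh_p p x > 0" using sinh_p_pos assms by simp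
  have c: "cosh_p p x > 0"
    using cosh_p_eq[OF assms] one_plus_powr_pos[of "sinh_p p x" p] by simp
  \<comment> \<open>\<open>b\<close> contributes one further factor sinh_p x / x, raising the
    exponent from p to p + 1.\<close>
  have "a * b = (sinh_p p x / x) powr (p + 1) / cosh_p p x"
    using s assms by (simp add: a_def b_def tanh_p_def powr_add)
  also have "\<dots> > 1"
    using cosh_p_less_sinh_p_div_powr[OF assms] c by simp
  finally have ab: "a * b > 1" .
  have "a \<ge> 0" "b \<ge> 0" using s c assms by (auto simp: a_def b_def tanh_p_def)
  \<comment> \<open>Strictness comes from the product bound, so the weak mean inequality is
    enough.\<close>
  have "1 < sqrt (a * b)" using ab by simp
  also have "\<dots> \<le> (a + b) / 2"
    using \<open>a \<ge> 0\<close> \<open>b \<ge> 0\<close> by (rule arith_geo_mean_sqrt)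
  finally have "a + b > 2" by simp
  then show ?thesis by (simp only: a_def b_def)
qed

end
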